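(* (i) Every Eulerian digraph $G$ with $n$ vertices and $m \ge 1$ arcs has an Eulerian subgraph $H$ with at least one arc such that every vertex of $H$ has out-degree (equivalently in-degree) in $H$ at least $\frac{m^2}{24n^3}$. (ii) This bound is tight up to a constant factor for infinitely many $m,n$: there is an absolute constant $C>0$ such that for infinitely many pairs $(m,n)$ there exists an Eulerian digraph $G$ with $n$ vertices and $m$ arcs in which every Eulerian subgraph with at least one arc has a vertex of out-degree at most $C\,\frac{m^2}{n^3}$.
   Context: All digraphs are finite and simple: no loops and no multiple arcs, but two arcs in opposite directions between the same pair of vertices are allowed. A digraph is Eulerian if every vertex has in-degree equal to its out-degree. The vertex set of a subgraph $H$ is taken to be the set of vertices incident to arcs of $H$; the minimum degree of an Eulerian digraph is the minimum over its vertices of the out-degree (which equals the in-degree). *)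

theory Defs
  imports Complex_Main "Graph_Theory.Digraph_Component"
begin

locale eulerian_digraph = digraph +
  assumes in_degree_eq_out_degree: "v \<in> verts G \<Longrightarrow> in_degree G v = out_degree G v"

text \<open>
  \<^const>\<open>subgraph\<close> allows isolated vertices in the subgraph; here the vertex set of a
  subgraph consists exactly of the end points of its arcs.
\<close>
definition eulerian_subgraph :: "('a, 'b) pre_digraph \<Rightarrow> ('a, 'b) pre_digraph \<Rightarrow> bool" where
  "eulerian_subgraph H G \<longleftrightarrow>
     subgraph H G \<and> eulerian_digraph H \<and> verts H = tail H ` arcs H \<union> head H ` arcs H"

end

theory Submission
  imports Defs "HOL-Library.Disjoint_Sets"
begin

text \<open>
  Arrange the \<open>n\<close> vertices on a cycle in some linear order. The cyclic lengths of the \<open>m\<close> arcs of an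
  Eulerian digraph add up to \<open>n\<close> times the number of backward arcs, and each length occurs at most
  \<open>n\<close> times; hence every ordering has more than \<open>m\<^sup>2 / (2 n\<^sup>2)\<close> backward arcs. Conversely, a digraph
  without closed walks of length at most \<open>4 j\<close> has an ordering with at most \<open>2 n\<^sup>2 / j\<^sup>2\<close> backward arcs:
  recursively cut off an in- or out-ball of radius below \<open>2 j\<close> with a small boundary, which exists since
  otherwise both balls around a vertex would grow quadratically and fill more than half of the digraph.
  So there is always a cycle of length at most \<open>12 n\<^sup>2 / m\<close>, and removing such cycles greedily
  decomposes the digraph into at least \<open>m\<^sup>2 / (24 n\<^sup>2)\<close> cycles. Now repeatedly discard all cycles
  through a vertex of degree below \<open>m\<^sup>2 / (24 n\<^sup>3)\<close>; as this happens at most once for each vertex,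
  some cycles survive.
\<close>

section \<open>Arc sets as binary relations\<close>

text \<open>Simple digraphs become sets of pairs, so that walks are relational powers. The
  quantifier runs over the whole type because both counts vanish away from the arcs.\<close>

definition balanced :: "('a \<times> 'a) set \<Rightarrow> bool" where
  "balanced R \<longleftrightarrow> (\<forall>v. card {e \<in> R. fst e = v} = card {e \<in> R. snd e = v})"

text \<open>Connectedness is irrelevant here, so a circuit is a vertex-disjoint union of directed cycles.\<close>

definition circuit :: "('a \<times> 'a) set \<Rightarrow> bool" where
  "circuit C \<longleftrightarrow> finite C \<and> C \<noteq> {} \<and> inj_on fst C \<and> inj_on snd C \<and> fst ` C = snd ` C"

section \<open>Growth of balls and sparse cuts\<close>

text \<open>Here \<open>s i\<close> is the size of a ball of radius \<open>i\<close>. Two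
  consecutive increments have product at least \<open>q * s\<close>, so by AM-GM their sum is at
  least of order \<open>sqrt (q * s)\<close>; summing over pairs of steps yields quadratic
  growth.\<close>

lemma quadratic_growth:
  fixes s :: "nat \<Rightarrow> real" and q :: real
  assumes "mono s" and "0 \<le> q" and "0 \<le> s 0" and s2: "1 \<le> j \<Longrightarrow> q \<le> s 2"
    and step: "\<And>k. 1 \<le> k \<Longrightarrow> k < j \<Longrightarrow>
      q * s (2*k+1) \<le> (s (2*k+1) - s (2*k)) * (s (2*k+2) - s (2*k+1))"
  shows "k \<le> j \<Longrightarrow> 4/9 * q * (real k)\<^sup>2 \<le> s (2*k)"
proof (induction k)
  case 0
  then show ?case using assms by simp
next
  case (Suc k)
  show ?case
  proof (cases "k = 0")
    case True
    then show ?thesis using s2 Suc.prems \<open>0 \<le> q\<close> by (simp add: numeral_2_eq_2)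
  next
    case False
    then have k: "1 \<le> k" "k < j" using Suc.prems by auto
    define a b where "a = s (2*k+1) - s (2*k)" and "b = s (2*k+2) - s (2*k+1)"
    have IH: "4/9 * q * (real k)\<^sup>2 \<le> s (2*k)" using Suc by simp
    have ab: "0 \<le> a" "0 \<le> b" using \<open>mono s\<close> by (auto simp: a_def b_def mono_def)
    have "s (2*k) \<le> s (2*k+1)" using ab by (simp add: a_def)
    then have "q * (4/9 * q * (real k)\<^sup>2) \<le> q * s (2*k+1)"
      using IH \<open>0 \<le> q\<close> by (intro mult_left_mono) auto
    also have "\<dots> \<le> a * b" unfolding a_def b_def by (rule step[OF k])
    \<comment> \<open>AM-GM in the form 4ab \<le> (a + b)^2.\<close>
    finally have "4 * (q * (4/9 * q * (real k)\<^sup>2)) \<le> (a + b)\<^sup>2"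
      using sum_power2_ge_zero[of "a - b" 0] by (simp add: power2_eq_square algebra_simps)
    then have "(4/3 * q * real k)\<^sup>2 \<le> (a + b)\<^sup>2" by (simp add: power2_eq_square algebra_simps)
    then have "4/3 * q * real k \<le> a + b" using ab by (meson add_nonneg_nonneg power2_le_imp_le)
    then have "4/9 * q * (real k)\<^sup>2 + 4/3 * q * real k \<le> s (2*k+2)"
      using IH by (simp add: a_def b_def)
    \<comment> \<open>The induction closes because 2k + 1 \<le> 3k for k \<ge> 1, which is why
      \<open>k = 0\<close> is treated separately by \<open>s2\<close>.\<close>
    moreover have "4/9 * q * (real (Suc k))\<^sup>2 \<le> 4/9 * q * (real k)\<^sup>2 + 4/3 * q * real k"
    proof -
      have "q * 1 \<le> q * real k" using k \<open>0 \<le> q\<close> by (intro mult_left_mono) auto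
      moreover have "4/9 * q * (real (Suc k))\<^sup>2 = 4/9 * q * (real k)\<^sup>2 + 8/9 * (q * real k) + 4/9 * q"
        by (simp add: power2_eq_square field_simps)
      ultimately show ?thesis by simp
    qed
    ultimately show ?thesis by simp
  qed
qed

text \<open>The arcs leaving a ball run between two consecutive layers, so a large boundary forces a
  large product of layer sizes. If every ball of radius below \<open>2*j\<close> had a large
  boundary, \<open>quadratic_growth\<close> would push the ball of radius \<open>2*j\<close> beyond
  \<open>half\<close>.\<close>

lemma ball_with_small_boundary:
  fixes R :: "('a \<times> 'a) set" and v :: 'a and B :: "nat \<Rightarrow> 'a set"
  defines "B \<equiv> \<lambda>i. {u. \<exists>k\<le>i. (v, u) \<in> R ^^ k}"
  assumes fin: "finite V" and R: "R \<subseteq> V \<times> V" and v: "v \<in> V" and j: "1 \<le> j"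
    and V2: "2 \<le> card V" and half: "2 * card (B (2*j)) \<le> card V + 1"
  shows "\<exists>S \<subseteq> V. S \<noteq> {} \<and> S \<noteq> V \<and>
    real (card (R \<inter> S \<times> (V - S))) \<le> 4 / (real j)\<^sup>2 * card S * (real (card V) - card S)"
proof (rule ccontr)
  assume neg: "\<not> ?thesis"
  have big: "4 / (real j)\<^sup>2 * card S * (real (card V) - card S) < real (card (R \<inter> S \<times> (V - S)))"
    if "S \<subseteq> V" "S \<noteq> {}" "S \<noteq> V" for S
  proof (rule ccontr)
    assume "\<not> ?thesis"
    then show False using neg that by (meson not_less)
  qed
  define n where "n = real (card V)"
  define s where "s = (\<lambda>i. real (card (B i)))"
  \<comment> \<open>Layers of vertices at distance exactly \<open>i\<close>. Radius 0 is separate,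
    since \<open>0 - 1 = 0\<close> would make that layer empty.\<close>
  define L where "L = (\<lambda>i. if i = 0 then B 0 else B i - B (i - 1))"
  have BV: "B i \<subseteq> V" for i
  proof
    fix u assume "u \<in> B i"
    then obtain k where "(v, u) \<in> R ^^ k" by (auto simp: B_def)
    then show "u \<in> V" using v R by (cases k) auto
  qed
  have finB: "finite (B i)" for i using BV fin finite_subset by blast
  have B0: "B 0 = {v}" by (auto simp: B_def)
  have Bmono: "B i \<subseteq> B i'" if "i \<le> i'" for i i'
    using that by (auto simp: B_def intro: le_trans)
  have smono: "mono s" unfolding s_def mono_def using Bmono finB by (simp add: card_mono)
  have s_le: "2 * s i \<le> n + 1" if "i \<le> 2*j" for i
  proof -
    have "s i \<le> s (2*j)" using smono that by (simp add: mono_def)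
    moreover have "2 * s (2*j) \<le> n + 1" using half unfolding s_def n_def by linarith
    ultimately show ?thesis by linarith
  qed
  have n2: "2 \<le> n" using V2 by (simp add: n_def)
  have bound: "4 / (real j)\<^sup>2 * s i * (n - s i) < real (card (L i)) * card (L (Suc i))"
    if i: "i < 2*j" for i
  proof -
    \<comment> \<open>An arc starting in an inner layer would still end inside
      \<open>B i\<close>.\<close>
    have "R \<inter> B i \<times> (V - B i) \<subseteq> L i \<times> L (Suc i)"
    proof clarify
      fix u w assume uw: "(u, w) \<in> R" "u \<in> B i" "w \<notin> B i"
      have next_ball: "w \<in> B (Suc i')" if "u \<in> B i'" for i'
      proof -
        from that obtain k where k: "k \<le> i'" "(v, u) \<in> R ^^ k" by (auto simp: B_def)
        then have "(v, w) \<in> R ^^ Suc k" using uw(1) by auto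
        then show ?thesis using k(1) unfolding B_def by blast
      qed
      show "u \<in> L i \<and> w \<in> L (Suc i)"
        using uw next_ball[of i] next_ball[of "i - 1"] by (cases i) (auto simp: L_def)
    qed
    then have "card (R \<inter> B i \<times> (V - B i)) \<le> card (L i \<times> L (Suc i))"
      by (intro card_mono) (auto simp: L_def finB)
    then have "real (card (R \<inter> B i \<times> (V - B i))) \<le> real (card (L i)) * card (L (Suc i))"
      by (metis card_cartesian_product of_nat_le_iff of_nat_mult)
    moreover have "B i \<noteq> {}" using B0 Bmono[of 0 i] by auto
    moreover have "B i \<noteq> V"
      using s_le[of i] i n2 by (auto simp: s_def n_def)
    ultimately show ?thesis
      using big[OF BV[of i]] unfolding s_def n_def by linarith
  qed
  have L_Suc: "real (card (L (Suc i))) = s (Suc i) - s i" for i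
    using Bmono[of i "Suc i"] finB by (simp add: L_def s_def card_Diff_subset of_nat_diff card_mono)
  have L0: "real (card (L 0)) = 1" by (simp add: L_def B0)
  \<comment> \<open>The boundary bound makes the next layer nonempty; the vertex gained improves
    \<open>n + 1\<close> to \<open>n - 1\<close>, and hence
    \<open>n \<le> 2 * (n - s i)\<close>.\<close>
  have strict: "2 * s i \<le> n - 1" if i: "i < 2*j" for i
  proof -
    have "0 \<le> 4 / (real j)\<^sup>2 * s i * (n - s i)"
      using s_le[of i] i n2 by (intro mult_nonneg_nonneg) (auto simp: s_def)
    then have "card (L (Suc i)) \<noteq> 0" using bound[OF i] by (intro notI) simp
    then have "s i + 1 \<le> s (Suc i)" using L_Suc[of i] by linarith
    then show ?thesis using s_le[of "Suc i"] i by simp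
  qed
  define q where "q = 2 / (real j)\<^sup>2 * n"
  have q0: "0 \<le> q" using n2 by (simp add: q_def)
  have prod: "q * s i \<le> real (card (L i)) * card (L (Suc i))" if i: "i < 2*j" for i
  proof -
    have "q * s i = 2 / (real j)\<^sup>2 * s i * n" by (simp add: q_def)
    also have "\<dots> \<le> 2 / (real j)\<^sup>2 * s i * (2 * (n - s i))"
      using strict[OF i] by (intro mult_left_mono) (auto simp: s_def)
    also have "\<dots> = 4 / (real j)\<^sup>2 * s i * (n - s i)" by simp
    finally show ?thesis using bound[OF i] by linarith
  qed
  have "4/9 * q * (real j)\<^sup>2 \<le> s (2*j)"
  proof (rule quadratic_growth[where j = j and k = j and s = s])
    show "mono s" by fact
    show "0 \<le> q" by fact
    show "0 \<le> s 0" by (simp add: s_def)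
    have "q \<le> s 1 - s 0" using prod[of 0] j L_Suc[of 0] L0 B0 by (simp add: s_def)
    also have "\<dots> \<le> s 2" using smono monoD[OF smono, of 1 2] by (simp add: s_def)
    finally show "q \<le> s 2" .
    show "q * s (2*k+1) \<le> (s (2*k+1) - s (2*k)) * (s (2*k+2) - s (2*k+1))" if "k < j" for k
      using prod[of "2*k+1"] L_Suc[of "2*k"] L_Suc[of "2*k+1"] that by simp
  qed simp
  \<comment> \<open>This exceeds (n + 1)/2 as soon as n \<ge> 2.\<close>
  then have "8/9 * n \<le> s (2*j)" using j by (simp add: q_def)
  then show False using s_le[of "2*j"] n2 by linarith
qed

section \<open>Orderings with few backward arcs\<close>

text \<open>Place \<open>A\<close> before \<open>B\<close>: a backward arc then lies inside one part
  or goes from \<open>B\<close> to \<open>A\<close>.\<close>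

lemma ordering_append:
  fixes R :: "('a \<times> 'a) set" and p q :: "'a \<Rightarrow> nat"
  assumes "finite V" and V: "V = A \<union> B" "A \<inter> B = {}" and R: "R \<subseteq> V \<times> V"
    and p: "bij_betw p A {..<card A}" and q: "bij_betw q B {..<card B}"
  shows "\<exists>r. bij_betw r V {..<card V} \<and>
    card {e \<in> R. r (snd e) < r (fst e)} \<le>
      card {e \<in> R \<inter> A \<times> A. p (snd e) < p (fst e)} + card {e \<in> R \<inter> B \<times> B. q (snd e) < q (fst e)}
      + card (R \<inter> B \<times> A)"
proof -
  define r where "r = (\<lambda>x. if x \<in> A then p x else card A + q x)"
  have fin: "finite A" "finite B" using assms by auto
  have finR: "finite R" using assms finite_subset by blast
  have c: "card V = card A + card B" using V fin by (simp add: card_Un_disjoint)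
  have rA: "bij_betw r A {..<card A}"
    using p by (rule bij_betw_cong[THEN iffD1, rotated]) (simp add: r_def)
  have "bij_betw (\<lambda>x. card A + q x) B ((+) (card A) ` {..<card B})"
    using bij_betw_trans[OF q, of "(+) (card A)"] by (simp add: bij_betw_def o_def)
  then have "bij_betw r B ((+) (card A) ` {..<card B})"
    by (rule bij_betw_cong[THEN iffD1, rotated]) (use V in \<open>auto simp: r_def\<close>)
  moreover have "(+) (card A) ` {..<card B} = {card A..<card A + card B}"
    by (simp add: lessThan_atLeast0 add.commute)
  ultimately have rB: "bij_betw r B {card A..<card A + card B}" by simp
  have "bij_betw r (A \<union> B) ({..<card A} \<union> {card A..<card A + card B})"
    by (rule bij_betw_combine[OF rA rB]) auto
  moreover have "{..<card A} \<union> {card A..<card A + card B} = {..<card V}" using c by auto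
  ultimately have bij: "bij_betw r V {..<card V}" using V by simp
  have "{e \<in> R. r (snd e) < r (fst e)} \<subseteq> {e \<in> R \<inter> A \<times> A. p (snd e) < p (fst e)}
     \<union> {e \<in> R \<inter> B \<times> B. q (snd e) < q (fst e)} \<union> R \<inter> B \<times> A" (is "_ \<subseteq> ?X \<union> ?Y \<union> ?Z")
  proof
    fix e assume e: "e \<in> {e \<in> R. r (snd e) < r (fst e)}"
    obtain u w where uw: "e = (u, w)" by force
    have mem: "u \<in> A \<or> u \<in> B" "w \<in> A \<or> w \<in> B" "u \<in> B \<longleftrightarrow> u \<notin> A" "w \<in> B \<longleftrightarrow> w \<notin> A"
      using e uw R V by auto
    have "p u < card A" if "u \<in> A" using p that by (auto simp: bij_betw_def)
    then show "e \<in> ?X \<union> ?Y \<union> ?Z" using e uw mem by (auto simp: r_def split: if_splits)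
  qed
  then have "card {e \<in> R. r (snd e) < r (fst e)} \<le> card (?X \<union> ?Y \<union> ?Z)"
    using finR by (intro card_mono) auto
  also have "\<dots> \<le> card ?X + card ?Y + card ?Z"
    by (meson add_le_mono1 card_Un_le le_trans)
  finally show ?thesis using bij by blast
qed

lemma relpow_converse_iff:
  fixes R :: "('a \<times> 'a) set"
  shows "(x, y) \<in> (R\<inverse>) ^^ k \<longleftrightarrow> (y, x) \<in> R ^^ k"
proof (induction k arbitrary: x y)
  case (Suc k)
  have "(x, y) \<in> (R\<inverse>) ^^ Suc k \<longleftrightarrow> (y, x) \<in> R O R ^^ k" using Suc by auto
  then show ?case by (simp add: relpow_commute)
qed auto

lemma relpow_subset:
  fixes Q R :: "('a \<times> 'a) set"
  shows "Q \<subseteq> R \<Longrightarrow> Q ^^ k \<subseteq> R ^^ k"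
  by (induction k) (auto intro: relcomp_mono)

text \<open>Induction on \<open>V\<close>: without short closed walks the out-ball and the in-ball
  around a vertex are almost disjoint, so one of them is small enough for
  \<open>ball_with_small_boundary\<close>. Both sides of the resulting cut are ordered
  recursively.\<close>

lemma ordering_with_few_backward_arcs:
  fixes R :: "('a \<times> 'a) set"
  assumes "finite V" and "R \<subseteq> V \<times> V" and j: "1 \<le> j"
    and "\<And>v k. 1 \<le> k \<Longrightarrow> k \<le> 4*j \<Longrightarrow> (v, v) \<notin> R ^^ k"
  shows "\<exists>p. bij_betw p V {..<card V} \<and>
    real (card {e \<in> R. p (snd e) < p (fst e)}) \<le> 2 * (real (card V))\<^sup>2 / (real j)\<^sup>2"
  using assms(1,2,4)
proof (induction V arbitrary: R rule: finite_psubset_induct)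
  case (psubset V)
  note R = psubset.prems(1) and girth = psubset.prems(2)
  show ?case
  proof (cases "2 \<le> card V")
    case False
    obtain p where p: "bij_betw p V {0..<card V}"
      using ex_bij_betw_finite_nat[OF psubset.hyps(1)] by blast
    have "card V = 0 \<or> card V = 1" using False by linarith
    then obtain x where "V \<subseteq> {x}" using psubset.hyps(1) by (auto simp: card_1_singleton_iff)
    then have "R \<subseteq> {(x, x)}" using R by blast
    then have "R = {}" using girth[of 1 x] j by auto
    then show ?thesis using p by (auto simp: lessThan_atLeast0)
  next
    case True
    then obtain v where v: "v \<in> V" by fastforce
    let ?out = "{u. \<exists>k\<le>2*j. (v, u) \<in> R ^^ k}" and ?in = "{u. \<exists>k\<le>2*j. (v, u) \<in> (R\<inverse>) ^^ k}"
    have sub: "?out \<subseteq> V" "?in \<subseteq> V"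
    proof -
      have "u \<in> V" if "(v, u) \<in> Q ^^ k" "Q \<subseteq> V \<times> V" for u k Q
        using that v by (cases k) auto
      then show "?out \<subseteq> V" "?in \<subseteq> V" using R by blast+
    qed
    \<comment> \<open>A common vertex closes a walk of length at most \<open>4*j\<close> through
      \<open>v\<close>, which must therefore have length 0.\<close>
    have "?out \<inter> ?in \<subseteq> {v}"
    proof
      fix u assume "u \<in> ?out \<inter> ?in"
      then obtain k l where kl: "k \<le> 2*j" "l \<le> 2*j" "(v, u) \<in> R ^^ k" "(u, v) \<in> R ^^ l"
        by (auto simp: relpow_converse_iff)
      then have "(v, v) \<in> R ^^ (k + l)" by (auto simp: relpow_add)
      then have "k + l = 0" using girth[of "k + l" v] kl by fastforce
      then show "u \<in> {v}" using kl by simp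
    qed
    then have "card (?out \<inter> ?in) \<le> 1" using card_mono[of "{v}"] by fastforce
    moreover have "card (?out \<union> ?in) \<le> card V" using sub psubset.hyps(1) by (intro card_mono) auto
    moreover have "card ?out + card ?in = card (?out \<union> ?in) + card (?out \<inter> ?in)"
      using sub[THEN finite_subset] psubset.hyps(1) by (intro card_Un_Int) blast+
    ultimately have "card ?out + card ?in \<le> card V + 1" by linarith
    then consider "2 * card ?out \<le> card V + 1" | "2 * card ?in \<le> card V + 1" by linarith
    then have "\<exists>A B. V = A \<union> B \<and> A \<inter> B = {} \<and> A \<noteq> {} \<and> B \<noteq> {} \<and>
      real (card (R \<inter> B \<times> A)) \<le> 4 / (real j)\<^sup>2 * card A * card B"
    proof cases
      case 1
      from ball_with_small_boundary[OF psubset.hyps(1) R v j True 1] obtain S where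
        S: "S \<subseteq> V" "S \<noteq> {}" "S \<noteq> V" "real (card (R \<inter> S \<times> (V - S)))
          \<le> 4 / (real j)\<^sup>2 * card S * (real (card V) - card S)" by blast
      have "real (card (V - S)) = real (card V) - card S"
        using S(1) psubset.hyps(1) by (simp add: card_Diff_subset finite_subset card_mono of_nat_diff)
      \<comment> \<open>Few arcs leave \<open>S\<close>, so \<open>S\<close> is placed last.\<close>
      then show ?thesis using S by (intro exI[of _ "V - S"] exI[of _ S]) (auto simp: mult_ac)
    next
      case 2
      from R have "R\<inverse> \<subseteq> V \<times> V" by blast
      from ball_with_small_boundary[OF psubset.hyps(1) this v j True 2] obtain S where
        S: "S \<subseteq> V" "S \<noteq> {}" "S \<noteq> V" "real (card (R\<inverse> \<inter> S \<times> (V - S)))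
          \<le> 4 / (real j)\<^sup>2 * card S * (real (card V) - card S)" by blast
      \<comment> \<open>Arcs of the converse leaving \<open>S\<close> are arcs of \<open>R\<close>
        entering \<open>S\<close>, so here \<open>S\<close> is placed first.\<close>
      have "R\<inverse> \<inter> S \<times> (V - S) = (R \<inter> (V - S) \<times> S)\<inverse>" by blast
      then have "card (R\<inverse> \<inter> S \<times> (V - S)) = card (R \<inter> (V - S) \<times> S)" by simp
      moreover have "real (card (V - S)) = real (card V) - card S"
        using S(1) psubset.hyps(1) by (simp add: card_Diff_subset finite_subset card_mono of_nat_diff)
      ultimately show ?thesis using S by (intro exI[of _ S] exI[of _ "V - S"]) (auto simp: mult_ac)
    qed
    then obtain A B where AB: "V = A \<union> B" "A \<inter> B = {}" "A \<noteq> {}" "B \<noteq> {}"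
      "real (card (R \<inter> B \<times> A)) \<le> 4 / (real j)\<^sup>2 * card A * card B" by blast
    have IH: "\<exists>p. bij_betw p S {..<card S} \<and> real (card {e \<in> R \<inter> S \<times> S. p (snd e) < p (fst e)})
      \<le> 2 * (real (card S))\<^sup>2 / (real j)\<^sup>2" if "S \<subset> V" for S
    proof (rule psubset.IH[OF that])
      show "(v, v) \<notin> (R \<inter> S \<times> S) ^^ k" if "1 \<le> k" "k \<le> 4*j" for v k
        using girth[OF that] relpow_subset[of "R \<inter> S \<times> S" R k] by blast
    qed blast
    obtain p where p: "bij_betw p A {..<card A}"
      "real (card {e \<in> R \<inter> A \<times> A. p (snd e) < p (fst e)}) \<le> 2 * (real (card A))\<^sup>2 / (real j)\<^sup>2"
      using IH[of A] AB by blast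
    obtain q where q: "bij_betw q B {..<card B}"
      "real (card {e \<in> R \<inter> B \<times> B. q (snd e) < q (fst e)}) \<le> 2 * (real (card B))\<^sup>2 / (real j)\<^sup>2"
      using IH[of B] AB by blast
    obtain r where r: "bij_betw r V {..<card V}" "card {e \<in> R. r (snd e) < r (fst e)} \<le>
      card {e \<in> R \<inter> A \<times> A. p (snd e) < p (fst e)} + card {e \<in> R \<inter> B \<times> B. q (snd e) < q (fst e)}
      + card (R \<inter> B \<times> A)"
      using ordering_append[OF psubset.hyps(1) AB(1,2) R p(1) q(1)] by blast
    have "card V = card A + card B"
      using AB psubset.hyps(1) by (simp add: card_Un_disjoint)
    \<comment> \<open>The recursion loses nothing: 2(a + b)^2 = 2a^2 + 2b^2 + 4ab, the last term
      paying for the cut.\<close>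
    then have "2 * (real (card V))\<^sup>2 / (real j)\<^sup>2 = 2 * (real (card A))\<^sup>2 / (real j)\<^sup>2
      + 2 * (real (card B))\<^sup>2 / (real j)\<^sup>2 + 4 / (real j)\<^sup>2 * card A * card B"
      using j by (simp add: field_simps power2_eq_square)
    then have "real (card {e \<in> R. r (snd e) < r (fst e)}) \<le> 2 * (real (card V))\<^sup>2 / (real j)\<^sup>2"
      using r(2) p(2) q(2) AB(5) by linarith
    then show ?thesis using r(1) by blast
  qed
qed

section \<open>Every ordering of a balanced arc set has many backward arcs\<close>

text \<open>The extreme case takes each of 1, 2, 3, ... exactly \<open>n\<close> times. Induction
  removes an element of maximal value \<open>M\<close>: all values lie in 1..M, so
  \<open>card X \<le> n * M\<close>.\<close>

lemma sum_ge_of_small_fibres: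
  fixes f :: "'a \<Rightarrow> nat"
  assumes "finite X" and "\<And>x. x \<in> X \<Longrightarrow> 1 \<le> f x" and "\<And>l. card {x \<in> X. f x = l} \<le> n"
  shows "(card X)\<^sup>2 + card X \<le> 2 * n * sum f X"
  using assms
proof (induction "card X" arbitrary: X)
  case 0
  then show ?case by simp
next
  case (Suc c)
  then have "X \<noteq> {}" by auto
  define M where "M = Max (f ` X)"
  have "M \<in> f ` X" unfolding M_def using Suc \<open>X \<noteq> {}\<close> by (intro Max_in) auto
  then obtain x where x: "x \<in> X" "f x = M" by auto
  have "X \<subseteq> (\<Union>l\<in>{1..M}. {x \<in> X. f x = l})"
    using Suc.prems unfolding M_def by (auto simp: Suc_le_eq)
  then have "card X \<le> card (\<Union>l\<in>{1..M}. {x \<in> X. f x = l})"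
    using Suc.prems by (intro card_mono) auto
  also have "\<dots> \<le> (\<Sum>l\<in>{1..M}. card {x \<in> X. f x = l})" by (rule card_UN_le) simp
  also have "\<dots> \<le> (\<Sum>l\<in>{1..M}. n)" by (intro sum_mono Suc.prems)
  finally have 1: "card X \<le> n * M" by (simp add: mult.commute)
  have c: "c = card (X - {x})" using Suc.hyps(2) x Suc.prems by simp
  have "(card (X - {x}))\<^sup>2 + card (X - {x}) \<le> 2 * n * sum f (X - {x})"
  proof (rule Suc.hyps(1)[OF c])
    show "card {y \<in> X - {x}. f y = l} \<le> n" for l
      using card_mono[of "{y \<in> X. f y = l}" "{y \<in> X - {x}. f y = l}"] Suc.prems(1) Suc.prems(3)[of l]
      by fastforce
  qed (use Suc.prems in auto)
  moreover have "sum f X = M + sum f (X - {x})" using x Suc.prems by (simp add: sum.remove)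
  ultimately show ?case
    using 1 c Suc.hyps(2)[symmetric] by (simp add: power2_eq_square algebra_simps)
qed

text \<open>Grouped by vertex, both sides weight \<open>g v\<close> by the common degree of
  \<open>v\<close>. Integer values permit the subtraction that cancels vertex potentials.\<close>

lemma balanced_sum_fst_snd:
  fixes g :: "'a \<Rightarrow> int"
  assumes "finite V" and R: "R \<subseteq> V \<times> V" and "balanced R"
  shows "(\<Sum>e\<in>R. g (fst e)) = (\<Sum>e\<in>R. g (snd e))"
proof -
  have fin: "finite R" using assms finite_subset by blast
  have "(\<Sum>e\<in>R. g (fst e)) = (\<Sum>v\<in>V. \<Sum>e\<in>{e \<in> R. fst e = v}. g (fst e))"
    using fin assms by (intro sum.group[symmetric]) auto
  also have "\<dots> = (\<Sum>v\<in>V. int (card {e \<in> R. fst e = v}) * g v)" by (intro sum.cong) auto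
  also have "\<dots> = (\<Sum>v\<in>V. int (card {e \<in> R. snd e = v}) * g v)"
    using \<open>balanced R\<close> by (simp add: balanced_def)
  also have "\<dots> = (\<Sum>v\<in>V. \<Sum>e\<in>{e \<in> R. snd e = v}. g (snd e))" by (intro sum.cong) auto
  also have "\<dots> = (\<Sum>e\<in>R. g (snd e))" using fin assms by (intro sum.group) auto
  finally show ?thesis .
qed

text \<open>Double counting of cyclic arc lengths: their sum is known exactly from balance, and
  bounded below by \<open>sum_ge_of_small_fibres\<close>.\<close>

lemma backward_arcs_ge:
  fixes R :: "('a \<times> 'a) set" and p :: "'a \<Rightarrow> nat"
  assumes fin: "finite V" and R: "R \<subseteq> V \<times> V" and bal: "balanced R" and irr: "irrefl R"
    and p: "bij_betw p V {..<card V}"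
  shows "(card R)\<^sup>2 + card R \<le> 2 * (card V)\<^sup>2 * card {e \<in> R. p (snd e) < p (fst e)}"
proof -
  let ?n = "card V" and ?B = "{e \<in> R. p (snd e) < p (fst e)}"
  have finR: "finite R" using fin R finite_subset by blast
  have pn: "p x < ?n" if "x \<in> V" for x using p that by (auto simp: bij_betw_def)
  have inj: "inj_on p V" using p by (simp add: bij_betw_def)
  \<comment> \<open>Length of the arc when the ordering is wrapped around a cycle: the lengths of a balanced set
    of arcs add up to n times the number of backward arcs.\<close>
  define f where "f = (\<lambda>e. if p (snd e) < p (fst e) then p (snd e) + ?n - p (fst e)
    else p (snd e) - p (fst e))"
  have f_int: "int (f e) = int (p (snd e)) - int (p (fst e)) + (if e \<in> ?B then int ?n else 0)"
    if "e \<in> R" for e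
    using that R pn[of "fst e"] by (auto simp: f_def of_nat_diff)
  have "int (sum f R) = (\<Sum>e\<in>R. int (p (snd e)) - int (p (fst e)) + (if e \<in> ?B then int ?n else 0))"
    using f_int by (simp add: of_nat_sum cong: sum.cong)
  also have "\<dots> = (\<Sum>e\<in>R. if e \<in> ?B then int ?n else 0)"
    using balanced_sum_fst_snd[OF fin R bal, of "\<lambda>x. int (p x)"]
    by (simp add: sum.distrib sum_subtractf)
  also have "\<dots> = int (?n * card ?B)"
    using finR by (simp add: sum.If_cases Int_def conj_commute cong: conj_cong)
  finally have sum_f: "sum f R = ?n * card ?B" by (simp only: of_nat_eq_iff)
  have "(card R)\<^sup>2 + card R \<le> 2 * ?n * sum f R"
  proof (rule sum_ge_of_small_fibres[OF finR])
    fix e assume e: "e \<in> R"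
    then have "fst e \<noteq> snd e" using irr by (cases e) (auto simp: irrefl_def)
    then have "p (fst e) \<noteq> p (snd e)" using e R inj by (metis SigmaE fst_conv inj_on_contraD snd_conv subsetD)
    then show "1 \<le> f e" using e R pn[of "fst e"] by (auto simp: f_def)
  next
    fix l
    \<comment> \<open>Tail and cyclic length determine the head, so each length occurs at most once
      per tail.\<close>
    have "inj_on fst {e \<in> R. f e = l}"
    proof (rule inj_onI)
      fix a b assume ab: "a \<in> {e \<in> R. f e = l}" "b \<in> {e \<in> R. f e = l}" "fst a = fst b"
      then have V: "fst a \<in> V" "snd a \<in> V" "snd b \<in> V" using R by auto
      have "f a = f b" using ab by simp
      then have "p (snd a) = p (snd b)"
        using ab(3) pn[OF V(1)] pn[OF V(2)] pn[OF V(3)] by (simp add: f_def split: if_splits)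
      then have "snd a = snd b" using inj V by (simp add: inj_on_def)
      then show "a = b" using ab(3) by (simp add: prod_eq_iff)
    qed
    then show "card {e \<in> R. f e = l} \<le> ?n"
      by (rule card_inj_on_le) (use R fin in auto)
  qed
  then show ?thesis by (simp add: sum_f power2_eq_square algebra_simps)
qed

section \<open>Short circuits\<close>

text \<open>A shortest closed walk, minimised over all starting vertices, repeats no vertex: a
  repetition would cut out a shorter one.\<close>

lemma circuit_of_closed_walk:
  fixes R :: "('a \<times> 'a) set"
  assumes "(v, v) \<in> R ^^ k" and "1 \<le> k"
  shows "\<exists>C \<subseteq> R. circuit C \<and> card C \<le> k"
proof -
  let ?P = "\<lambda>k. 1 \<le> k \<and> (\<exists>v. (v, v) \<in> R ^^ k)"
  define l where "l = (LEAST k. ?P k)"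
  have "?P k" using assms by blast
  then have l: "?P l" unfolding l_def by (rule LeastI)
  have least: "l \<le> i" if "?P i" for i unfolding l_def using that by (rule Least_le)
  from l obtain w where "(w, w) \<in> R ^^ l" by blast
  then obtain f where f: "f 0 = w" "f l = w" "\<And>i. i < l \<Longrightarrow> (f i, f (Suc i)) \<in> R"
    by (auto simp: relpow_fun_conv)
  \<comment> \<open>The condition \<open>b - a < l\<close> exempts only the pair 0,
    \<open>l\<close>, so both windows 0..l-1 and 1..l are free of repetitions.\<close>
  have neq: "f a \<noteq> f b" if "a < b" "b \<le> l" "b - a < l" for a b
  proof
    assume "f a = f b"
    then have "(f a, f a) \<in> R ^^ (b - a)"
      using that f(3) by (auto simp: relpow_fun_conv intro!: exI[of _ "\<lambda>i. f (a + i)"])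
    then have "?P (b - a)" using that by auto
    then show False using least that(3) by fastforce
  qed
  have inj0: "inj_on f {..<l}"
    by (rule linorder_inj_onI) (use neq in auto)
  have inj1: "inj_on (\<lambda>i. f (Suc i)) {..<l}"
    by (rule linorder_inj_onI) (use neq in auto)
  define C where "C = (\<lambda>i. (f i, f (Suc i))) ` {..<l}"
  have "f ` {..<l} = (\<lambda>i. f (Suc i)) ` {..<l}"
  proof -
    obtain l' where l': "l = Suc l'" using l by (cases l) auto
    have "(\<lambda>i. f (Suc i)) ` {..<l} = insert (f l) ((\<lambda>i. f (Suc i)) ` {..<l'})"
      by (simp add: l' lessThan_Suc)
    also have "\<dots> = f ` {..<l}"
      by (simp add: l' lessThan_Suc_eq_insert_0 image_image f(1,2)[unfolded l'])
    finally show ?thesis by simp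
  qed
  then have "fst ` C = snd ` C" by (simp add: C_def image_image)
  moreover have "inj_on fst C" "inj_on snd C"
    using inj0 inj1 by (auto simp: C_def inj_on_def)
  moreover have "C \<noteq> {}" "finite C" using l by (auto simp: C_def lessThan_empty_iff)
  moreover have "card C \<le> k"
    using card_image_le[of "{..<l}" "\<lambda>i. (f i, f (Suc i))"] least[OF \<open>?P k\<close>] by (simp add: C_def)
  moreover have "C \<subseteq> R" using f(3) by (auto simp: C_def)
  ultimately show ?thesis unfolding circuit_def by blast
qed

text \<open>If no closed walk had length at most \<open>4*j\<close>, the upper and lower bounds on
  backward arcs would contradict each other.\<close>

lemma short_circuit:
  fixes R :: "('a \<times> 'a) set"
  assumes fin: "finite V" and R: "R \<subseteq> V \<times> V" and bal: "balanced R" and ne: "R \<noteq> {}"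
  shows "\<exists>C \<subseteq> R. circuit C \<and> card C * card R \<le> 12 * (card V)\<^sup>2"
proof -
  let ?n = "card V" and ?m = "card R"
  \<comment> \<open>The factor 3 serves both ends: \<open>j * ?m\<close> is at most 3n^2, giving
    length at most 12n^2/m, and rounding down costs less than m \<le> n^2, so it stays at least the
    2n^2 needed for the contradiction.\<close>
  define j where "j = (3 * ?n\<^sup>2) div ?m"
  have finR: "finite R" using fin R finite_subset by blast
  have m: "1 \<le> ?m" using ne finR by (simp add: Suc_le_eq card_gt_0_iff)
  have mn: "?m \<le> ?n\<^sup>2"
    using card_mono[OF _ R] fin by (simp add: card_cartesian_product power2_eq_square)
  have jm: "j * ?m \<le> 3 * ?n\<^sup>2" by (simp add: j_def)
  have "3 * ?n\<^sup>2 < j * ?m + ?m"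
    unfolding j_def using m mod_less_divisor[of ?m "3 * ?n\<^sup>2"] div_mult_mod_eq[of "3 * ?n\<^sup>2" ?m]
    by linarith
  then have jm2: "2 * ?n\<^sup>2 \<le> j * ?m" using mn by linarith
  have j1: "1 \<le> j"
  proof (rule ccontr)
    assume "\<not> 1 \<le> j"
    then have "j = 0" by simp
    then show False using jm2 mn m by simp
  qed
  have "\<exists>v k. 1 \<le> k \<and> k \<le> 4*j \<and> (v, v) \<in> R ^^ k"
  proof (rule ccontr)
    assume "\<not> ?thesis"
    then have girth: "\<And>v k. 1 \<le> k \<Longrightarrow> k \<le> 4*j \<Longrightarrow> (v, v) \<notin> R ^^ k" by blast
    have "irrefl R" using girth[of 1] j1 by (auto simp: irrefl_def)
    obtain p where p: "bij_betw p V {..<?n}"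
      "real (card {e \<in> R. p (snd e) < p (fst e)}) \<le> 2 * (real ?n)\<^sup>2 / (real j)\<^sup>2"
      using ordering_with_few_backward_arcs[OF fin R j1 girth] by blast
    let ?b = "card {e \<in> R. p (snd e) < p (fst e)}"
    \<comment> \<open>Strictness comes from the extra summand \<open>card R\<close> in
      \<open>backward_arcs_ge\<close>.\<close>
    have "?m\<^sup>2 < 2 * ?n\<^sup>2 * ?b"
      using backward_arcs_ge[OF fin R bal \<open>irrefl R\<close> p(1)] m by linarith
    then have "(j * ?m)\<^sup>2 < 2 * ?n\<^sup>2 * (?b * j\<^sup>2)"
      using j1 by (simp add: power_mult_distrib mult_ac)
    moreover have "?b * j\<^sup>2 \<le> 2 * ?n\<^sup>2"
    proof -
      have "real ?b * (real j)\<^sup>2 \<le> 2 * (real ?n)\<^sup>2" using p(2) j1 by (simp add: field_simps)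
      then have "real (?b * j\<^sup>2) \<le> real (2 * ?n\<^sup>2)" by simp
      then show ?thesis by (simp only: of_nat_le_iff)
    qed
    then have "2 * ?n\<^sup>2 * (?b * j\<^sup>2) \<le> 2 * ?n\<^sup>2 * (2 * ?n\<^sup>2)" by (intro mult_left_mono) auto
    ultimately have "(j * ?m)\<^sup>2 < (2 * ?n\<^sup>2)\<^sup>2"
      unfolding power2_eq_square[of "2 * ?n\<^sup>2"] by (rule less_le_trans)
    then show False using jm2 by (meson le_less_trans less_irrefl power_mono zero_le)
  qed
  then obtain v k where k: "1 \<le> k" "k \<le> 4*j" "(v, v) \<in> R ^^ k" by blast
  obtain C where C: "C \<subseteq> R" "circuit C" "card C \<le> k" using circuit_of_closed_walk[OF k(3,1)] by blast
  have "card C * ?m \<le> 4 * j * ?m" using C k by (intro mult_right_mono) auto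
  also have "\<dots> \<le> 12 * ?n\<^sup>2" using jm by simp
  finally show ?thesis using C by blast
qed

section \<open>Decomposition into many circuits\<close>

lemma balanced_circuit: "circuit C \<Longrightarrow> balanced C"
proof -
  assume C: "circuit C"
  have one: "card {e \<in> C. h e = v} = (if v \<in> h ` C then 1 else 0)" if "inj_on h C" for h :: "_ \<Rightarrow> 'a" and v
  proof (cases "v \<in> h ` C")
    case True
    then obtain e where "e \<in> C" "h e = v" by blast
    then have "{e \<in> C. h e = v} = {e}" using that by (auto simp: inj_on_def)
    then show ?thesis using True by simp
  next
    case False
    then have "{e \<in> C. h e = v} = {}" by blast
    then have "card {e \<in> C. h e = v} = 0" by (simp only: card.empty)
    then show ?thesis using False by simp
  qed
  show ?thesis using C unfolding balanced_def circuit_def by (simp add: one)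
qed

lemma balanced_Diff:
  assumes "finite R" and "C \<subseteq> R" and "balanced R" and "balanced C"
  shows "balanced (R - C)"
proof -
  have "card {e \<in> R - C. P e} = card {e \<in> R. P e} - card {e \<in> C. P e}" for P
  proof -
    have "{e \<in> R - C. P e} = {e \<in> R. P e} - {e \<in> C. P e}" by blast
    then show ?thesis using assms by (simp add: card_Diff_subset Collect_mono finite_subset subset_iff)
  qed
  then show ?thesis using assms by (simp add: balanced_def)
qed

lemma balanced_Union:
  assumes "finite F" and "disjoint F" and "\<And>C. C \<in> F \<Longrightarrow> finite C \<and> balanced C"
  shows "balanced (\<Union>F)"
proof -
  have "card {e \<in> \<Union>F. P e} = (\<Sum>C\<in>F. card {e \<in> C. P e})" for P
  proof -
    have "{e \<in> \<Union>F. P e} = (\<Union>C\<in>F. {e \<in> C. P e})" by blast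
    then show ?thesis
      using assms by (simp, intro card_UN_disjoint) (auto simp: disjoint_def)
  qed
  then show ?thesis using assms by (simp add: balanced_def)
qed

text \<open>Greedy removal of short circuits: each one lowers the squared number of arcs by at most
  24n^2.\<close>

lemma circuit_decomposition:
  fixes R :: "('a \<times> 'a) set"
  assumes fin: "finite V" and "R \<subseteq> V \<times> V" and "balanced R"
  shows "\<exists>F. finite F \<and> disjoint F \<and> \<Union>F = R \<and> (\<forall>C\<in>F. circuit C) \<and>
    (card R)\<^sup>2 \<le> 24 * (card V)\<^sup>2 * card F"
  using assms(2,3)
proof (induction "card R" arbitrary: R rule: less_induct)
  case less
  have finR: "finite R" using fin less finite_subset by blast
  show ?case
  proof (cases "R = {}")
    case True
    then show ?thesis by (intro exI[of _ "{}"]) simp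
  next
    case False
    obtain C where C: "C \<subseteq> R" "circuit C" "card C * card R \<le> 12 * (card V)\<^sup>2"
      using short_circuit[OF fin less.prems False] by blast
    have "finite C" "C \<noteq> {}" using C by (auto simp: circuit_def)
    have "card (R - C) < card R" using C(1) \<open>C \<noteq> {}\<close> finR by (intro psubset_card_mono) auto
    moreover have "balanced (R - C)" using balanced_Diff[OF finR C(1) less.prems(2) balanced_circuit[OF C(2)]] .
    ultimately obtain F where F: "finite F" "disjoint F" "\<Union>F = R - C" "\<forall>C\<in>F. circuit C"
      "(card (R - C))\<^sup>2 \<le> 24 * (card V)\<^sup>2 * card F"
      using less.hyps[of "R - C"] less.prems by blast
    have "C \<notin> F" using F(3) \<open>C \<noteq> {}\<close> by blast
    then have c: "card (insert C F) = Suc (card F)" using F(1) by simp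
    have split: "card R = card (R - C) + card C"
      using C(1) finR \<open>finite C\<close> by (simp add: card_Diff_subset card_mono)
    \<comment> \<open>With r arcs left and c removed, (r + c)^2 \<le> r^2 + 2c(r + c), and
      \<open>C\<close> was chosen with c(r + c) \<le> 12n^2.\<close>
    have "(card R)\<^sup>2 \<le> (card (R - C))\<^sup>2 + 2 * (card C * card R)"
      unfolding split by (simp add: power2_eq_square algebra_simps)
    also have "\<dots> \<le> 24 * (card V)\<^sup>2 * card (insert C F)" using F(5) C(3) c by (simp add: algebra_simps)
    finally have "(card R)\<^sup>2 \<le> 24 * (card V)\<^sup>2 * card (insert C F)" .
    moreover have "disjoint (insert C F)" using F(2,3) by (auto simp: disjoint_def)
    moreover have "\<Union>(insert C F) = R" using F(3) C(1) by blast
    ultimately show ?thesis using F C by (intro exI[of _ "insert C F"]) auto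
  qed
qed

section \<open>Subfamilies of high minimum degree\<close>

text \<open>\<open>W\<close> holds the vertices that may still be covered. Discarding all circuits
  through a vertex of degree below \<open>d\<close> removes that vertex from \<open>W\<close> and
  fewer than \<open>d\<close> circuits from \<open>F\<close>, so the inequality between
  \<open>card W * d\<close> and \<open>card F\<close> persists.\<close>

lemma dense_subfamily:
  fixes F :: "('a \<times> 'a) set set" and d :: real
  assumes "finite W" and "finite F" and "disjoint F" and "\<And>C. C \<in> F \<Longrightarrow> circuit C"
    and "fst ` \<Union>F \<subseteq> W" and "F \<noteq> {}" and "card W * d \<le> card F"
  shows "\<exists>F' \<subseteq> F. F' \<noteq> {} \<and> (\<forall>v \<in> fst ` \<Union>F'. d \<le> card {e \<in> \<Union>F'. fst e = v})"
  using assms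
proof (induction W arbitrary: F rule: finite_psubset_induct)
  case (psubset W)
  note F = psubset.prems
  show ?case
  proof (cases "\<forall>v \<in> fst ` \<Union>F. d \<le> card {e \<in> \<Union>F. fst e = v}")
    case True
    then show ?thesis using F(5) by (intro exI[of _ F]) simp
  next
    case False
    then obtain v where v: "v \<in> fst ` \<Union>F" "card {e \<in> \<Union>F. fst e = v} < d"
      by (meson not_less)
    define D where "D = {C \<in> F. v \<in> fst ` C}"
    have "finite (\<Union>F)" using F by (auto simp: circuit_def)
    have "\<forall>C\<in>D. \<exists>e. e \<in> C \<and> fst e = v" by (auto simp: D_def)
    \<comment> \<open>Each circuit through \<open>v\<close> contributes its own arc leaving
      \<open>v\<close>, by disjointness; hence \<open>card D\<close> is at most the degree of
      \<open>v\<close>.\<close>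
    then obtain h where h: "\<And>C. C \<in> D \<Longrightarrow> h C \<in> C \<and> fst (h C) = v" by metis
    have "inj_on h D"
    proof (rule inj_onI)
      fix A B assume AB: "A \<in> D" "B \<in> D" "h A = h B"
      then have "A \<inter> B \<noteq> {}" using h by (metis disjoint_iff)
      then show "A = B" using AB F(2) by (auto simp: D_def disjoint_def)
    qed
    moreover have "D \<subseteq> F" by (auto simp: D_def)
    then have "h ` D \<subseteq> {e \<in> \<Union>F. fst e = v}" using h by blast
    moreover have "finite {e \<in> \<Union>F. fst e = v}" using \<open>finite (\<Union>F)\<close> by (rule rev_finite_subset) blast
    ultimately have "card D \<le> card {e \<in> \<Union>F. fst e = v}" by (rule card_inj_on_le)
    then have D: "card D < d" using v(2) by linarith
    have vW: "v \<in> W" using v(1) F(4) by (rule subsetD[rotated])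
    have cD: "real (card (F - D)) = real (card F) - card D"
      using F(1) by (simp add: D_def card_Diff_subset card_mono of_nat_diff)
    have cW: "real (card (W - {v})) = real (card W) - 1"
      using card_Suc_Diff1[OF psubset.hyps(1) vW] by linarith
    have lt: "card (W - {v}) * d < card (F - D)"
      using D F(6) by (simp add: cD cW algebra_simps)
    \<comment> \<open>\<open>d\<close> is positive because it exceeds \<open>card D\<close>; the
      strict inequality \<open>lt\<close> then shows that some circuits survive.\<close>
    have "0 \<le> card (W - {v}) * d" using D by (intro mult_nonneg_nonneg) auto
    then have "card (F - D) \<noteq> 0" using lt by linarith
    then have "F - D \<noteq> {}" by (metis card.empty)
    have "\<exists>F' \<subseteq> F - D. F' \<noteq> {} \<and> (\<forall>v \<in> fst ` \<Union>F'. d \<le> card {e \<in> \<Union>F'. fst e = v})"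
    proof (rule psubset.IH)
      show "W - {v} \<subset> W" using vW by blast
      show "disjoint (F - D)" using F(2) by (auto simp: disjoint_def)
      show "fst ` \<Union>(F - D) \<subseteq> W - {v}" using F(4) by (auto simp: D_def)
      show "card (W - {v}) * d \<le> card (F - D)" using lt by simp
      show "finite (F - D)" using F(1) by simp
      show "circuit C" if "C \<in> F - D" for C using that F(3) by simp
    qed (rule \<open>F - D \<noteq> {}\<close>)
    then show ?thesis by (meson Diff_subset order_trans)
  qed
qed

lemma balanced_subset_of_high_degree:
  fixes R :: "('a \<times> 'a) set"
  assumes fin: "finite V" and R: "R \<subseteq> V \<times> V" and "balanced R" and ne: "R \<noteq> {}"
  shows "\<exists>Q \<subseteq> R. Q \<noteq> {} \<and> balanced Q \<and> fst ` Q = snd ` Q \<and>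
    (\<forall>v \<in> fst ` Q. (real (card R))\<^sup>2 / (24 * real (card V) ^ 3) \<le> card {e \<in> Q. fst e = v})"
proof -
  obtain F where F: "finite F" "disjoint F" "\<Union>F = R" "\<forall>C\<in>F. circuit C"
    "(card R)\<^sup>2 \<le> 24 * (card V)\<^sup>2 * card F"
    using circuit_decomposition[OF fin R \<open>balanced R\<close>] by blast
  let ?d = "(real (card R))\<^sup>2 / (24 * real (card V) ^ 3)"
  have "V \<noteq> {}" using R ne by blast
  then have n: "0 < real (card V)" using fin by (simp add: card_gt_0_iff)
  have "real ((card R)\<^sup>2) \<le> real (24 * (card V)\<^sup>2 * card F)" using F(5) by (simp only: of_nat_le_iff)
  \<comment> \<open>The cube in the denominator is the n^2 of the decomposition times one factor n
    for the at most n discarding rounds.\<close>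
  then have "card V * ?d \<le> card F"
    using n by (simp add: field_simps power2_eq_square power3_eq_cube)
  moreover have "fst ` \<Union>F \<subseteq> V" using F(3) R by auto
  moreover have "F \<noteq> {}" using F(3) ne by auto
  ultimately obtain F' where F': "F' \<subseteq> F" "F' \<noteq> {}"
    "\<forall>v \<in> fst ` \<Union>F'. ?d \<le> card {e \<in> \<Union>F'. fst e = v}"
    using dense_subfamily[OF fin F(1,2), of ?d] F(4) by meson
  have "balanced (\<Union>F')"
  proof (rule balanced_Union)
    show "finite F'" using F F' finite_subset by blast
    show "disjoint F'" using F(2) F'(1) by (auto simp: disjoint_def)
    show "finite C \<and> balanced C" if "C \<in> F'" for C
    proof -
      have "circuit C" using that F(4) F'(1) by blast
      then show ?thesis by (simp add: balanced_circuit) (simp add: circuit_def)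
    qed
  qed
  moreover have "\<Union>F' \<noteq> {}"
  proof -
    have "C \<noteq> {}" if "C \<in> F'" for C using that F(4) F'(1) by (auto simp: circuit_def)
    then show ?thesis using F'(2) by blast
  qed
  moreover have "fst ` \<Union>F' = snd ` \<Union>F'"
  proof -
    have "fst ` C = snd ` C" if "C \<in> F'" for C
      using that F(4) F'(1) unfolding circuit_def by blast
    then show ?thesis by (simp add: image_Union)
  qed
  moreover have "\<Union>F' \<subseteq> R" using F(3) F'(1) by blast
  ultimately show ?thesis using F'(3) by (intro exI[of _ "\<Union>F'"] conjI)
qed

section \<open>Transfer to digraphs with abstract arcs\<close>

text \<open>Without parallel arcs, \<open>arc_to_ends\<close> is injective, so arcs may be exchanged
  for their pairs of ends and back without changing degrees.\<close>

lemma eulerian_subgraph_of_high_degree: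
  fixes G :: "('a, 'b) pre_digraph"
  assumes "eulerian_digraph G" and ne: "arcs G \<noteq> {}"
  shows "\<exists>H. eulerian_subgraph H G \<and> arcs H \<noteq> {} \<and> (\<forall>v \<in> verts H.
    (real (card (arcs G)))\<^sup>2 / (24 * real (card (verts G)) ^ 3) \<le> real (out_degree H v))"
proof -
  interpret eulerian_digraph G by fact
  let ?g = "arc_to_ends G"
  define R where "R = ?g ` arcs G"
  have card_ends: "card {a \<in> arcs G. ?g a \<in> Q \<and> P (?g a)} = card {e \<in> Q. P e}"
    if "Q \<subseteq> R" for Q P
  proof -
    have "?g ` {a \<in> arcs G. ?g a \<in> Q \<and> P (?g a)} = {e \<in> Q. P e}" using that by (auto simp: R_def)
    moreover have "inj_on ?g {a \<in> arcs G. ?g a \<in> Q \<and> P (?g a)}"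
      by (rule inj_on_subset[OF inj_on_arc_to_ends]) auto
    ultimately show ?thesis by (simp flip: card_image)
  qed
  have RV: "R \<subseteq> verts G \<times> verts G" by (auto simp: R_def arc_to_ends_def)
  have out_R: "card {e \<in> R. fst e = v} = out_degree G v"
    and in_R: "card {e \<in> R. snd e = v} = in_degree G v" for v
  proof -
    have "{a \<in> arcs G. ?g a \<in> R \<and> fst (?g a) = v} = out_arcs G v"
      "{a \<in> arcs G. ?g a \<in> R \<and> snd (?g a) = v} = in_arcs G v"
      by (auto simp: R_def arc_to_ends_def out_arcs_def in_arcs_def)
    then show "card {e \<in> R. fst e = v} = out_degree G v" "card {e \<in> R. snd e = v} = in_degree G v"
      using card_ends[OF order_refl, of "\<lambda>e. fst e = v"] card_ends[OF order_refl, of "\<lambda>e. snd e = v"]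
      by (simp_all add: out_degree_def in_degree_def)
  qed
  have "balanced R" unfolding balanced_def
  proof
    fix v
    show "card {e \<in> R. fst e = v} = card {e \<in> R. snd e = v}"
    proof (cases "v \<in> verts G")
      case True
      then show ?thesis by (simp add: out_R in_R in_degree_eq_out_degree)
    next
      case False
      then have "{e \<in> R. fst e = v} = {}" "{e \<in> R. snd e = v} = {}" using RV by auto
      then show ?thesis by (simp only:)
    qed
  qed
  moreover have "R \<noteq> {}" using ne by (simp add: R_def)
  moreover have card_R: "card R = card (arcs G)" by (simp add: R_def card_image inj_on_arc_to_ends)
  ultimately obtain Q where Q: "Q \<subseteq> R" "Q \<noteq> {}" "balanced Q" "fst ` Q = snd ` Q"
    "\<forall>v \<in> fst ` Q. (real (card (arcs G)))\<^sup>2 / (24 * real (card (verts G)) ^ 3)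
      \<le> card {e \<in> Q. fst e = v}"
    using balanced_subset_of_high_degree[OF finite_verts RV] unfolding card_R by meson
  define A where "A = {a \<in> arcs G. ?g a \<in> Q}"
  define H where "H = \<lparr>verts = tail G ` A \<union> head G ` A, arcs = A, tail = tail G, head = head G\<rparr>"
  have H: "verts H = tail G ` A \<union> head G ` A" "arcs H = A" "tail H = tail G" "head H = head G"
    by (simp_all add: H_def)
  have gA: "?g ` A = Q" using Q(1) by (auto simp: A_def R_def)
  have "tail G ` A = fst ` Q" "head G ` A = snd ` Q"
    unfolding gA[symmetric] by (simp_all add: image_image arc_to_ends_def)
  \<comment> \<open>Tails and heads of \<open>Q\<close> coincide, so the degree bound, stated for
    tails, reaches every vertex of \<open>H\<close>.\<close>
  then have vH: "verts H = fst ` Q" using Q(4) by (simp add: H)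
  have out_H: "out_degree H v = card {e \<in> Q. fst e = v}"
    and in_H: "in_degree H v = card {e \<in> Q. snd e = v}" for v
  proof -
    have "{a \<in> arcs G. ?g a \<in> Q \<and> fst (?g a) = v} = out_arcs H v"
      "{a \<in> arcs G. ?g a \<in> Q \<and> snd (?g a) = v} = in_arcs H v"
      by (auto simp: A_def H arc_to_ends_def out_arcs_def in_arcs_def)
    then show "out_degree H v = card {e \<in> Q. fst e = v}" "in_degree H v = card {e \<in> Q. snd e = v}"
      using card_ends[OF Q(1), of "\<lambda>e. fst e = v"] card_ends[OF Q(1), of "\<lambda>e. snd e = v"]
      by (simp_all add: out_degree_def in_degree_def)
  qed
  have "finite A" by (simp add: A_def)
  have AG: "A \<subseteq> arcs G" by (auto simp: A_def)
  have "eulerian_digraph H"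
  proof
    show "e1 = e2" if "e1 \<in> arcs H" "e2 \<in> arcs H" "arc_to_ends H e1 = arc_to_ends H e2" for e1 e2
      using that AG no_multi_arcs[of e1 e2] by (auto simp: H arc_to_ends_def)
    show "in_degree H v = out_degree H v" for v
      using Q(3) by (simp add: in_H out_H balanced_def)
  qed (use \<open>finite A\<close> AG no_loops in \<open>auto simp: H\<close>)
  moreover have "subgraph H G"
  proof (rule subgraphI)
    show "wf_digraph H" using \<open>eulerian_digraph H\<close>
      by (simp add: eulerian_digraph_def digraph_def fin_digraph_def)
    show "wf_digraph G" by (rule wf_digraph)
  qed (use AG in \<open>auto simp: H compatible_def\<close>)
  ultimately have "eulerian_subgraph H G" by (simp add: eulerian_subgraph_def H)
  moreover have "arcs H \<noteq> {}" using gA Q(2) by (auto simp: H)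
  ultimately show ?thesis using Q(5) by (intro exI[of _ H]) (simp add: vH out_H)
qed

section \<open>Tightness for complete digraphs\<close>

definition complete_digraph :: "nat \<Rightarrow> (nat, nat \<times> nat) pre_digraph" where
  "complete_digraph n =
    \<lparr>verts = {..<n}, arcs = {(u, v). u < n \<and> v < n \<and> u \<noteq> v}, tail = fst, head = snd\<rparr>"

lemma out_arcs_complete_digraph:
  "v < n \<Longrightarrow> out_arcs (complete_digraph n) v = Pair v ` ({..<n} - {v})"
  by (auto simp: out_arcs_def complete_digraph_def)

lemma in_arcs_complete_digraph:
  "v < n \<Longrightarrow> in_arcs (complete_digraph n) v = (\<lambda>u. (u, v)) ` ({..<n} - {v})"
  by (auto simp: in_arcs_def complete_digraph_def)

lemma out_degree_complete_digraph: "v < n \<Longrightarrow> out_degree (complete_digraph n) v = n - 1"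
  unfolding out_degree_def out_arcs_complete_digraph by (subst card_image) (auto simp: inj_on_def)

lemma in_degree_complete_digraph: "v < n \<Longrightarrow> in_degree (complete_digraph n) v = n - 1"
  unfolding in_degree_def in_arcs_complete_digraph by (subst card_image) (auto simp: inj_on_def)

lemma finite_arcs_complete_digraph: "finite (arcs (complete_digraph n))"
  by (rule finite_subset[of _ "{..<n} \<times> {..<n}"]) (auto simp: complete_digraph_def)

lemma eulerian_complete_digraph: "eulerian_digraph (complete_digraph n)"
proof
  show "in_degree (complete_digraph n) v = out_degree (complete_digraph n) v"
    if "v \<in> verts (complete_digraph n)" for v
    using that in_degree_complete_digraph out_degree_complete_digraph
    by (simp add: complete_digraph_def)
qed (use finite_arcs_complete_digraph in
  \<open>auto simp: complete_digraph_def arc_to_ends_def\<close>)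

lemma card_arcs_complete_digraph: "card (arcs (complete_digraph n)) = n * (n - 1)"
proof -
  have "arcs (complete_digraph n) = (SIGMA u:{..<n}. {..<n} - {u})"
    by (auto simp: complete_digraph_def)
  then show ?thesis by simp
qed

text \<open>For complete digraphs the bound \<open>m\<^sup>2 / n\<^sup>3\<close> is of order \<open>n\<close>, which no out-degree exceeds.\<close>

lemma complete_digraph_tight:
  assumes "2 \<le> n" and "eulerian_subgraph H (complete_digraph n)" and "arcs H \<noteq> {}"
  shows "\<exists>v \<in> verts H. real (out_degree H v) \<le> 2 * ((real (n * (n - 1)))\<^sup>2 / real n ^ 3)"
proof -
  have sub: "subgraph H (complete_digraph n)" and vH: "verts H = tail H ` arcs H \<union> head H ` arcs H"
    using assms by (auto simp: eulerian_subgraph_def)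
  then obtain v where v: "v \<in> verts H" using assms(3) by blast
  then have vn: "v < n" using sub by (auto simp: subgraph_def complete_digraph_def)
  have "out_arcs H v \<subseteq> out_arcs (complete_digraph n) v"
    using sub by (auto simp: subgraph_def compatible_def out_arcs_def)
  moreover have "finite (out_arcs (complete_digraph n) v)"
    using finite_arcs_complete_digraph by (simp add: out_arcs_def)
  ultimately have "out_degree H v \<le> n - 1"
    unfolding out_degree_complete_digraph[OF vn, symmetric] by (simp add: out_degree_def card_mono)
  then have "real (out_degree H v) \<le> real n - 1" using assms(1) by linarith
  also have "\<dots> \<le> 2 * ((real (n * (n - 1)))\<^sup>2 / real n ^ 3)"
  proof -
    \<comment> \<open>The constant 2 comes from n \<le> 2(n - 1) for n \<ge> 2, since here m^2/n^3 =
      (n - 1)^2/n.\<close>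
    have "real n * (real n - 1) \<le> 2 * (real n - 1) * (real n - 1)"
      using assms(1) by (intro mult_right_mono) auto
    then have "real n - 1 \<le> 2 * (real n - 1) * (real n - 1) / real n"
      using assms(1) by (simp add: pos_le_divide_eq mult.commute)
    also have "\<dots> = 2 * ((real (n * (n - 1)))\<^sup>2 / real n ^ 3)"
      using assms(1) by (simp add: of_nat_diff power2_eq_square power3_eq_cube)
    finally show ?thesis .
  qed
  finally show ?thesis using v by blast
qed

theorem theorem1p4:
  shows "(\<forall>(G :: ('a, 'b) pre_digraph) (m :: nat) (n :: nat).
            eulerian_digraph G \<and> card (verts G) = n \<and> card (arcs G) = m \<and> m \<ge> 1 \<longrightarrow>
            (\<exists>H. eulerian_subgraph H G \<and> arcs H \<noteq> {} \<and>
                 (\<forall>v \<in> verts H. real (out_degree H v) \<ge> real m ^ 2 / (24 * real n ^ 3))))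
       \<and> (\<exists>C :: real. C > 0 \<and>
            infinite {(m :: nat, n :: nat). m \<ge> 1 \<and>
              (\<exists>G :: (nat, nat \<times> nat) pre_digraph.
                 eulerian_digraph G \<and> card (verts G) = n \<and> card (arcs G) = m \<and>
                 (\<forall>H. eulerian_subgraph H G \<and> arcs H \<noteq> {} \<longrightarrow>
                      (\<exists>v \<in> verts H. real (out_degree H v) \<le> C * (real m ^ 2 / real n ^ 3))))})"
proof (intro conjI allI impI exI[of _ "2 :: real"])
  fix G :: "('a, 'b) pre_digraph" and m n :: nat
  assume "eulerian_digraph G \<and> card (verts G) = n \<and> card (arcs G) = m \<and> m \<ge> 1"
  then show "\<exists>H. eulerian_subgraph H G \<and> arcs H \<noteq> {} \<and>
      (\<forall>v \<in> verts H. real (out_degree H v) \<ge> real m ^ 2 / (24 * real n ^ 3))"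
    using eulerian_subgraph_of_high_degree[of G] by fastforce
next
  let ?S = "{(m :: nat, n :: nat). m \<ge> 1 \<and>
    (\<exists>G :: (nat, nat \<times> nat) pre_digraph.
       eulerian_digraph G \<and> card (verts G) = n \<and> card (arcs G) = m \<and>
       (\<forall>H. eulerian_subgraph H G \<and> arcs H \<noteq> {} \<longrightarrow>
            (\<exists>v \<in> verts H. real (out_degree H v) \<le> 2 * (real m ^ 2 / real n ^ 3))))}"
  have "(n * (n - 1), n) \<in> ?S" if "2 \<le> n" for n
  proof -
    have "1 \<le> n * (n - 1)" using that by (cases n) auto
    moreover have "card (verts (complete_digraph n)) = n" by (simp add: complete_digraph_def)
    ultimately show ?thesis
      using eulerian_complete_digraph[of n] card_arcs_complete_digraph[of n]
        complete_digraph_tight[OF that] by blast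
  qed
  \<comment> \<open>The second component makes these pairs distinct, so there are infinitely
    many.\<close>
  then have "(\<lambda>n. (n * (n - 1), n)) ` {2..} \<subseteq> ?S" by auto
  moreover have "infinite ((\<lambda>n :: nat. (n * (n - 1), n)) ` {2..})"
    by (subst finite_image_iff) (auto simp: inj_on_def infinite_Ici)
  ultimately show "infinite ?S" by (rule infinite_super)
qed simp

end
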